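(* Let $\mathbb K$ be $\mathbb R$ or $\mathbb C$, let $T$, $Z$, $Y$ be open subsets of $\mathbb K^m$, $\mathbb K^n$, $\mathbb K^{n+m}$ respectively, and let $\Phi:T\times Z\to Y$ be an arc-wise analytic trivialization of the standard projection $\pi:\mathbb K^{n+m}\to\mathbb K^m$ (restricted to $Y$). Let $f:(Y,y_0)\to(\mathbb K,0)$, $y_0=\Phi(t_0,z_0)$, be a $\mathbb K$-analytic function germ that is $\Phi$-regular, and let $f_t$ denote the restriction of $f$ to $Y_t=Y\cap\pi^{-1}(t)$. Then for $t$ close to $t_0$ the following multiplicities are equal: $$\operatorname{mult}_{y_0}f=\operatorname{mult}_{\Phi(t,z_0)}f=\operatorname{mult}_{y_0}f_{t_0}=\operatorname{mult}_{\Phi(t,z_0)}f_t.$$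
   Context: $\mathbb K$-analytic means real analytic if $\mathbb K=\mathbb R$ and holomorphic if $\mathbb K=\mathbb C$. $\operatorname{mult}_p$ denotes the order of vanishing at $p$. A real analytic arc is a real analytic map from $I=(-1,1)$ (also if $\mathbb K=\mathbb C$); a map is arc-analytic if its composition with every real analytic arc is real analytic. An analytic stratification of an analytic space $X$ of dimension $n$ is a filtration by analytic subspaces $X=X_n\supset\cdots\supset X_0$ with each $X_j\setminus X_{j-1}$ empty or nonsingular of pure dimension $j$; strata are the connected components of these differences. $\Phi:T\times Z\to Y$ is an arc-wise analytic trivialization of $\pi:Y\to T$ if: (1) $\Phi$ is a subanalytic homeomorphism; (2) for every real analytic arc $z(s)$ in $Z$, $(t,s)\mapsto\Phi(t,z(s))$ is real analytic and, if $\mathbb K=\mathbb C$, complex analytic in $t$; (3) $\pi(\Phi(t,z))=t$; (4) $\Phi^{-1}$ is arc-analytic; (5) there are $\mathbb K$-analytic stratifications $\{Z_i\}$ of $Z$, $\{Y_i\}$ of $Y$ with $Y_i=\Phi(T\times Z_i)$ and $\Phi|_{T\times Z_i}:T\times Z_i\to Y_i$ a real analytic diffeomorphism. The germ $f$ at $y_0=\Phi(t_0,z_0)$ is $\Phi$-regular if there is $C>0$ such that $C^{-1}|f(\Phi(t_0,z))|\le|f(\Phi(t,z))|\le C|f(\Phi(t_0,z))|$ for all $(t,z)$ sufficiently close to $(t_0,z_0)$. *)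

theory Defs
  imports "HOL-Analysis.Analysis" "HOL-Library.Extended_Nat"
begin

subsection \<open>The base field\<close>

text \<open>The members of this class are exactly the fields of real and of complex numbers, up to an
  isometric isomorphism of real algebras (a multiplicative norm coming from an inner product makes
  \<open>1\<close> and \<open>i\<close> orthonormal).  The type \<open>'k^'n\<close> plays the role of $K^n$ and is at the same time a
  real Euclidean space, which is how real analytic notions are applied to it when $K = C$.\<close>

class real_or_complex = real_normed_field + euclidean_space +
  assumes real_or_complex:
    "(\<forall>x. \<exists>a. x = a *\<^sub>R 1) \<or>
     (\<exists>i. i * i = - 1 \<and> (\<forall>x. \<exists>a b. x = a *\<^sub>R 1 + b *\<^sub>R i))"

instance real :: real_or_complex
  by standard auto

instance complex :: real_or_complex
proof
  have "\<exists>a b. x = a *\<^sub>R 1 + b *\<^sub>R \<i>" for x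
    by (intro exI[of _ "Re x"] exI[of _ "Im x"]) (simp add: complex_eq_iff)
  then show "(\<forall>x::complex. \<exists>a. x = a *\<^sub>R 1) \<or>
     (\<exists>i::complex. i * i = - 1 \<and> (\<forall>x. \<exists>a b. x = a *\<^sub>R 1 + b *\<^sub>R i))"
    using i_squared by blast
qed

subsection \<open>Analytic functions and maps\<close>

text \<open>A space is described by finitely many scalar coordinate functions \<open>\<xi> i\<close>, \<open>i \<in> I\<close>.  This lets
  one definition serve $K^n$, real Euclidean spaces, and the spaces \<open>'a \<times> R^k\<close> with varying \<open>k\<close>
  occurring in the definition of subanalytic sets.  Multi-indices are the elements of
  \<open>I \<rightarrow>\<^sub>E UNIV\<close>.\<close>

definition polydisc :: "('i \<Rightarrow> 'a \<Rightarrow> 'k::real_normed_field) \<Rightarrow> 'i set \<Rightarrow> 'a \<Rightarrow> real \<Rightarrow> 'a set" where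
  "polydisc \<xi> I a r = {x. \<forall>i\<in>I. norm (\<xi> i x - \<xi> i a) < r}"

definition power_series_at ::
    "('i \<Rightarrow> 'a \<Rightarrow> 'k::real_normed_field) \<Rightarrow> 'i set \<Rightarrow> (('i \<Rightarrow> nat) \<Rightarrow> 'k) \<Rightarrow> ('a \<Rightarrow> 'k) \<Rightarrow> 'a \<Rightarrow> bool" where
  "power_series_at \<xi> I c f a \<longleftrightarrow>
     (\<exists>r>0. \<forall>x\<in>polydisc \<xi> I a r.
        ((\<lambda>\<alpha>. c \<alpha> * (\<Prod>i\<in>I. (\<xi> i x - \<xi> i a) ^ \<alpha> i)) has_sum f x) (I \<rightarrow>\<^sub>E UNIV))"

definition coord_analytic_at ::
    "('i \<Rightarrow> 'a \<Rightarrow> 'k::real_normed_field) \<Rightarrow> 'i set \<Rightarrow> ('a \<Rightarrow> 'k) \<Rightarrow> 'a \<Rightarrow> bool" where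
  "coord_analytic_at \<xi> I f a \<longleftrightarrow> (\<exists>c. power_series_at \<xi> I c f a)"

definition K_analytic_on :: "('k::real_or_complex^'n) set \<Rightarrow> ('k^'n \<Rightarrow> 'k) \<Rightarrow> bool" where
  "K_analytic_on U f \<longleftrightarrow> (\<forall>a\<in>U. coord_analytic_at (\<lambda>i x. x $ i) UNIV f a)"

definition K_analytic_map_on :: "('k::real_or_complex^'n) set \<Rightarrow> ('k^'n \<Rightarrow> 'k^'p) \<Rightarrow> bool" where
  "K_analytic_map_on U f \<longleftrightarrow> (\<forall>j. K_analytic_on U (\<lambda>x. f x $ j))"

definition real_analytic_on :: "'a::euclidean_space set \<Rightarrow> ('a \<Rightarrow> 'b::euclidean_space) \<Rightarrow> bool" where
  "real_analytic_on U f \<longleftrightarrow>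
     (\<forall>a\<in>U. \<forall>b\<in>Basis. coord_analytic_at (\<lambda>e x. x \<bullet> e) Basis (\<lambda>x. f x \<bullet> b) a)"

text \<open>The preceding notions are for open sets.  The next one is for arbitrary subsets, in
  particular submanifolds.\<close>

definition real_analytic_on_subset ::
    "'a::euclidean_space set \<Rightarrow> ('a \<Rightarrow> 'b::euclidean_space) \<Rightarrow> bool" where
  "real_analytic_on_subset S f \<longleftrightarrow>
     (\<forall>a\<in>S. \<exists>U g. open U \<and> a \<in> U \<and> real_analytic_on U g \<and> (\<forall>x\<in>S \<inter> U. f x = g x))"

definition analytic_arc_in :: "'a::euclidean_space set \<Rightarrow> (real \<Rightarrow> 'a) \<Rightarrow> bool" where
  "analytic_arc_in X \<gamma> \<longleftrightarrow> real_analytic_on {-1<..<1} \<gamma> \<and> \<gamma> ` {-1<..<1} \<subseteq> X"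

definition arc_analytic_on ::
    "'a::euclidean_space set \<Rightarrow> ('a \<Rightarrow> 'b::euclidean_space) \<Rightarrow> bool" where
  "arc_analytic_on X f \<longleftrightarrow>
     (\<forall>\<gamma>. analytic_arc_in X \<gamma> \<longrightarrow> real_analytic_on {-1<..<1} (\<lambda>s. f (\<gamma> s)))"

subsection \<open>Multiplicity\<close>

definition taylor_coeff :: "('k::real_or_complex^'n \<Rightarrow> 'k) \<Rightarrow> 'k^'n \<Rightarrow> ('n \<Rightarrow> nat) \<Rightarrow> 'k" where
  "taylor_coeff f p = (THE c. power_series_at (\<lambda>i x. x $ i) UNIV c f p)"

text \<open>The order of vanishing of an analytic germ; it is \<open>\<infinity>\<close> for the zero germ.\<close>

definition mult_at :: "'k::real_or_complex^'n \<Rightarrow> ('k^'n \<Rightarrow> 'k) \<Rightarrow> enat" where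
  "mult_at p f = (INF \<alpha>\<in>{\<alpha>. taylor_coeff f p \<alpha> \<noteq> 0}. enat (\<Sum>i\<in>UNIV. \<alpha> i))"

subsection \<open>Semianalytic and subanalytic sets\<close>

text \<open>In a pair \<open>(E, G)\<close> the functions in \<open>E\<close> give equations and those in \<open>G\<close> strict
  inequalities.\<close>

definition semianalytic_in ::
    "('i \<Rightarrow> 'a \<Rightarrow> real) \<Rightarrow> 'i set \<Rightarrow> 'a set \<Rightarrow> 'a set \<Rightarrow> bool" where
  "semianalytic_in \<xi> I M A \<longleftrightarrow> A \<subseteq> M \<and>
     (\<forall>a\<in>M. \<exists>r>0. \<exists>D. finite D \<and>
        (\<forall>(E, G)\<in>D. finite E \<and> finite G \<and>
           (\<forall>g\<in>E \<union> G. \<forall>x\<in>polydisc \<xi> I a r. coord_analytic_at \<xi> I g x)) \<and>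
        A \<inter> polydisc \<xi> I a r =
          {x\<in>polydisc \<xi> I a r. \<exists>(E, G)\<in>D. (\<forall>g\<in>E. g x = 0) \<and> (\<forall>g\<in>G. g x > 0)})"

text \<open>With the index set \<open>Basis <+> {..<k}\<close> these are the coordinates of \<open>'a \<times> R^k\<close>; a point of
  \<open>R^k\<close> is given by a sequence of which only the first \<open>k\<close> entries matter.\<close>

definition ext_coord :: "'a::euclidean_space + nat \<Rightarrow> 'a \<times> (nat \<Rightarrow> real) \<Rightarrow> real" where
  "ext_coord i p = (case i of Inl b \<Rightarrow> fst p \<bullet> b | Inr j \<Rightarrow> snd p j)"

text \<open>Subanalytic subsets of an open set \<open>M\<close>: locally (at all points of \<open>M\<close>) projections of
  relatively compact semianalytic subsets of \<open>M \<times> R^k\<close>.\<close>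

definition subanalytic_in :: "'a::euclidean_space set \<Rightarrow> 'a set \<Rightarrow> bool" where
  "subanalytic_in M A \<longleftrightarrow> A \<subseteq> M \<and>
     (\<forall>a\<in>M. \<exists>V k B. open V \<and> a \<in> V \<and>
        semianalytic_in ext_coord (Basis <+> {..<k}) (M \<times> UNIV) B \<and>
        (\<exists>C R. compact C \<and> C \<subseteq> M \<and> (\<forall>(x, u)\<in>B. x \<in> C \<and> (\<forall>j<k. \<bar>u j\<bar> \<le> R))) \<and>
        A \<inter> V = fst ` B)"

subsection \<open>Analytic stratifications\<close>

definition analytic_subset :: "('k::real_or_complex^'n) set \<Rightarrow> ('k^'n) set \<Rightarrow> bool" where
  "analytic_subset X A \<longleftrightarrow> A \<subseteq> X \<and>
     (\<forall>a\<in>X. \<exists>U G. open U \<and> a \<in> U \<and> finite G \<and> (\<forall>g\<in>G. K_analytic_on U g) \<and>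
        A \<inter> U = {x\<in>X \<inter> U. \<forall>g\<in>G. g x = 0})"

definition K_submanifold :: "nat \<Rightarrow> ('k::real_or_complex^'n) set \<Rightarrow> bool" where
  "K_submanifold j S \<longleftrightarrow>
     (\<forall>p\<in>S. \<exists>U V. \<exists>\<phi> \<psi> :: 'k^'n \<Rightarrow> 'k^'n. \<exists>J. open U \<and> p \<in> U \<and> open V \<and>
        homeomorphism U V \<phi> \<psi> \<and>
        K_analytic_map_on U \<phi> \<and> K_analytic_map_on V \<psi> \<and> card J = j \<and>
        \<phi> ` (S \<inter> U) = {x\<in>V. \<forall>i. i \<notin> J \<longrightarrow> x $ i = 0})"

definition level :: "(nat \<Rightarrow> 'a set) \<Rightarrow> nat \<Rightarrow> 'a set" where
  "level F j = F j - (\<Union>i<j. F i)"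

text \<open>Stratifications of an open subset \<open>X\<close> of $K^n$.  The strata are the connected components of
  the sets \<open>level F j\<close>.\<close>

definition analytic_stratification ::
    "('k::real_or_complex^'n) set \<Rightarrow> (nat \<Rightarrow> ('k^'n) set) \<Rightarrow> bool" where
  "analytic_stratification X F \<longleftrightarrow>
     F (CARD('n)) = X \<and> (\<forall>j<CARD('n). F j \<subseteq> F (Suc j)) \<and>
     (\<forall>j\<le>CARD('n). analytic_subset X (F j) \<and> K_submanifold j (level F j))"

subsection \<open>Arc-wise analytic trivializations\<close>

text \<open>$K^{n+m}$ is \<open>'k^('m + 'n)\<close>, with \<open>Inl\<close> indexing the coordinates of $K^m$ and \<open>Inr\<close>
  those of $K^n$.\<close>

definition std_proj :: "'k^('m::finite + 'n::finite) \<Rightarrow> 'k^'m" where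
  "std_proj y = (\<chi> i. y $ Inl i)"

definition fibre_coord :: "'k^('m::finite + 'n::finite) \<Rightarrow> 'k^'n" where
  "fibre_coord y = (\<chi> i. y $ Inr i)"

definition join_vec :: "'k^'m \<Rightarrow> 'k^'n \<Rightarrow> 'k^('m::finite + 'n::finite)" where
  "join_vec t x = (\<chi> i. case i of Inl j \<Rightarrow> t $ j | Inr j \<Rightarrow> x $ j)"

text \<open>The restriction of \<open>f\<close> to the fibre of \<open>std_proj\<close> over \<open>t\<close>, which is identified with $K^n$
  by \<open>fibre_coord\<close>.\<close>

definition fibre_restrict :: "('k^('m::finite + 'n::finite) \<Rightarrow> 'k) \<Rightarrow> 'k^'m \<Rightarrow> 'k^'n \<Rightarrow> 'k" where
  "fibre_restrict f t x = f (join_vec t x)"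

text \<open>In the second condition, analyticity in \<open>t\<close> over $K$ is automatic from the joint real
  analyticity when $K = R$.  In the last condition the members of the two stratifications that
  correspond to each other are indexed by dimension, whence the shift by \<open>m\<close>; \<open>\<Phi>\<close> is a real
  analytic diffeomorphism on the smooth pieces, not on the (possibly singular) sets of the
  filtration.  Working with all strata of one dimension together amounts, for connected \<open>T\<close>, to
  matching the single strata, and it also makes sense for disconnected \<open>T\<close>.\<close>

definition arcwise_analytic_trivialization ::
    "('k::real_or_complex^'m) set \<Rightarrow> ('k^'n) set \<Rightarrow> ('k^('m::finite + 'n::finite)) set \<Rightarrow>
     (('k^'m) \<times> ('k^'n) \<Rightarrow> 'k^('m::finite + 'n::finite)) \<Rightarrow> bool" where
  "arcwise_analytic_trivialization T Z Y \<Phi> \<longleftrightarrow>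
     (let \<Psi> = inv_into (T \<times> Z) \<Phi> in
      (homeomorphism (T \<times> Z) Y \<Phi> \<Psi> \<and>
       subanalytic_in ((T \<times> Z) \<times> Y) {(p, \<Phi> p) | p. p \<in> T \<times> Z}) \<and>
      (\<forall>z. analytic_arc_in Z z \<longrightarrow>
         real_analytic_on (T \<times> {-1<..<1}) (\<lambda>(t, s). \<Phi> (t, z s)) \<and>
         (\<forall>s\<in>{-1<..<1}. K_analytic_map_on T (\<lambda>t. \<Phi> (t, z s)))) \<and>
      (\<forall>t\<in>T. \<forall>z\<in>Z. std_proj (\<Phi> (t, z)) = t) \<and>
      arc_analytic_on Y \<Psi> \<and>
      (\<exists>FZ FY. analytic_stratification Z FZ \<and> analytic_stratification Y FY \<and>
         (\<forall>j<CARD('m). FY j = {}) \<and>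
         (\<forall>i\<le>CARD('n).
            FY (CARD('m) + i) = \<Phi> ` (T \<times> FZ i) \<and>
            \<Phi> ` (T \<times> level FZ i) = level FY (CARD('m) + i) \<and>
            real_analytic_on_subset (T \<times> level FZ i) \<Phi> \<and>
            real_analytic_on_subset (level FY (CARD('m) + i)) \<Psi>)))"

definition Phi_regular ::
    "(('k::real_or_complex^'m) \<times> ('k^'n) \<Rightarrow> 'k^('m::finite + 'n::finite)) \<Rightarrow> 'k^'m \<Rightarrow> 'k^'n \<Rightarrow>
     ('k^('m::finite + 'n::finite) \<Rightarrow> 'k) \<Rightarrow> bool" where
  "Phi_regular \<Phi> t0 z0 f \<longleftrightarrow>
     (\<exists>C>0. \<forall>\<^sub>F (t, z) in nhds (t0, z0).
        inverse C * norm (f (\<Phi> (t0, z))) \<le> norm (f (\<Phi> (t, z))) \<and>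
        norm (f (\<Phi> (t, z))) \<le> C * norm (f (\<Phi> (t0, z))))"

end

(* An analytic germ f satisfies m <= mult_p f iff f(x) = O(|x - p|^m), and it suffices to test this
   on real lines s |-> p + s v, s > 0, since a nonzero homogeneous polynomial does not vanish
   identically.  Take a line y(s) through Phi(t', z0) and let z(s) be the Z-component of
   Phi^{-1}(y(s)), a real analytic arc at z0.  By regularity f(y(s)) = O(f(Phi(t, z(s)))), and
   s |-> Phi(t, z(s)) is an analytic arc, hence Lipschitz at 0, inside the fibre over t.  So if f_t
   is O(|x|^m) at Phi(t, z0), then f(y(s)) = O(s^m).  This yields
   mult f_t (Phi(t, z0)) <= mult f (Phi(t', z0)) for all t, t' near t0, and the restriction to a
   fibre never lowers the multiplicity. *)
theory Submission
  imports Defs "HOL-Computational_Algebra.Polynomial"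
begin

section \<open>Convergent power series and their Taylor remainders\<close>

text \<open>In finite dimension unconditional convergence is absolute: each real coordinate series
  converges absolutely, and the norm is at most the sum of the absolute values of the
  coordinates.\<close>

lemma has_sum_imp_norm_summable:
  fixes f :: "'a \<Rightarrow> 'b::euclidean_space"
  assumes "(f has_sum S) A"
  shows "(\<lambda>x. norm (f x)) summable_on A"
proof (rule Infinite_Sum.abs_summable_on_comparison_test')
  have comp: "(\<lambda>x. \<bar>f x \<bullet> b\<bar>) summable_on A" for b
    using summable_on_bounded_linear[OF bounded_linear_inner_left, of f A b]
      has_sum_imp_summable[OF assms] summable_on_iff_abs_summable_on_real
    by (metis (no_types, lifting) real_norm_def summable_on_cong)
  have "(\<lambda>x. \<Sum>b\<in>B. \<bar>f x \<bullet> b\<bar>) summable_on A" if "finite B" for B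
    using that
    by (induction B rule: finite_induct) (simp_all add: summable_on_add comp)
  from this[OF finite_Basis] show "(\<lambda>x. \<Sum>b\<in>Basis. \<bar>f x \<bullet> b\<bar>) summable_on A" .
qed (rule norm_le_l1)

text \<open>The estimates are needed twice, for the K-coordinates of \<open>'k^'n\<close> and for
  the real coordinates of a Euclidean space. \<open>diagonal_point\<close> supplies a point at which
  every monomial of degree d equals the d-th power of \<open>\<rho>\<close>; convergence there
  controls all coefficients at once.\<close>

locale coordinates =
  fixes \<xi> :: "'i \<Rightarrow> 'a::real_normed_vector \<Rightarrow> 'k::{real_normed_field,euclidean_space}"
    and I :: "'i set"
  assumes finite_index: "finite I"
    and coord_le: "i \<in> I \<Longrightarrow> norm (\<xi> i x - \<xi> i y) \<le> norm (x - y)"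
    and diagonal_point: "\<exists>x. \<forall>i\<in>I. \<xi> i x - \<xi> i a = of_real \<rho>"
begin

abbreviation monomials_below :: "nat \<Rightarrow> ('i \<Rightarrow> nat) set" where
  "monomials_below m \<equiv> {\<alpha> \<in> I \<rightarrow>\<^sub>E UNIV. sum \<alpha> I < m}"

lemma finite_monomials_below: "finite (monomials_below m)"
proof (rule finite_subset)
  show "monomials_below m \<subseteq> I \<rightarrow>\<^sub>E {..<m}"
  proof (intro subsetI)
    fix \<alpha> assume \<alpha>: "\<alpha> \<in> monomials_below m"
    have "\<alpha> i < m" if "i \<in> I" for i
      using member_le_sum[OF that, of \<alpha>] \<alpha> finite_index by auto
    then show "\<alpha> \<in> I \<rightarrow>\<^sub>E {..<m}"
      using \<alpha> by (auto simp: PiE_iff)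
  qed
qed (use finite_index in \<open>auto intro: finite_PiE\<close>)

lemma polydisc_superset_ball: "ball a r \<subseteq> polydisc \<xi> I a r"
proof
  fix x assume "x \<in> ball a r"
  then have "norm (x - a) < r"
    by (simp add: dist_norm norm_minus_commute)
  then show "x \<in> polydisc \<xi> I a r"
    using coord_le[of _ x a] by (auto simp: polydisc_def intro: le_less_trans)
qed

text \<open>Absolute convergence at a diagonal point at distance \<open>\<rho>\<close> in every
  coordinate makes the coefficients, weighted by powers of \<open>\<rho>\<close>, summable. For x
  within \<open>\<rho>\<close> of a, each term of degree at least m is its weight times at most the
  m-th power of \<open>norm (x - a) / \<rho>\<close>, a factor that can be pulled out of the
  tail.\<close>

lemma taylor_remainder:
  assumes "power_series_at \<xi> I c f a"
  shows "\<exists>C\<ge>0. \<forall>\<^sub>F x in nhds a.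
    norm (f x - (\<Sum>\<alpha>\<in>monomials_below m. c \<alpha> * (\<Prod>i\<in>I. (\<xi> i x - \<xi> i a) ^ \<alpha> i))) \<le> C * norm (x - a) ^ m"
proof -
  let ?A = "I \<rightarrow>\<^sub>E (UNIV :: nat set)"
  define t where "t x \<alpha> = c \<alpha> * (\<Prod>i\<in>I. (\<xi> i x - \<xi> i a) ^ \<alpha> i)" for x \<alpha>
  obtain r where r: "r > 0" "\<And>x. x \<in> polydisc \<xi> I a r \<Longrightarrow> (t x has_sum f x) ?A"
    using assms unfolding power_series_at_def t_def by auto
  \<comment> \<open>Any radius strictly between 0 and r would do: the diagonal point
    \<open>x0\<close> must lie in the open polydisc of radius r.\<close>
  define \<rho> where "\<rho> = r / 2"
  have \<rho>: "0 < \<rho>" "\<rho> < r"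
    using r by (auto simp: \<rho>_def)
  obtain x0 where x0: "\<And>i. i \<in> I \<Longrightarrow> \<xi> i x0 - \<xi> i a = of_real \<rho>"
    using diagonal_point by blast
  define w where "w \<alpha> = norm (c \<alpha>) * \<rho> ^ sum \<alpha> I" for \<alpha>
  have w_nonneg: "w \<alpha> \<ge> 0" for \<alpha>
    using \<rho> by (simp add: w_def)
  have "norm (t x0 \<alpha>) = w \<alpha>" for \<alpha>
    using x0 \<rho> by (simp add: t_def w_def norm_mult prod_norm[symmetric] norm_power power_sum)
  moreover have "(t x0 has_sum f x0) ?A"
    using r(2) x0 \<rho> by (auto simp: polydisc_def)
  ultimately have "w summable_on ?A"
    using has_sum_imp_norm_summable by fastforce
  then have W: "w summable_on (?A - monomials_below m)"
    by (rule summable_on_subset) auto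
  define M where "M = infsum w (?A - monomials_below m)"
  have M: "(w has_sum M) (?A - monomials_below m)"
    using W by (simp add: M_def)
  have "M \<ge> 0"
    unfolding M_def by (rule infsum_nonneg) (use w_nonneg in auto)
  have "norm (f x - (\<Sum>\<alpha>\<in>monomials_below m. t x \<alpha>)) \<le> M * (norm (x - a) / \<rho>) ^ m"
    if x: "x \<in> ball a \<rho>" for x
  proof (rule norm_infsum_le)
    have "x \<in> polydisc \<xi> I a r"
      using polydisc_superset_ball[of a r] x \<rho> by auto
    then show "(t x has_sum (f x - (\<Sum>\<alpha>\<in>monomials_below m. t x \<alpha>))) (?A - monomials_below m)"
      using finite_monomials_below by (intro has_sum_Diff r has_sum_finite) auto
    show "((\<lambda>\<alpha>. w \<alpha> * (norm (x - a) / \<rho>) ^ m) has_sum M * (norm (x - a) / \<rho>) ^ m) (?A - monomials_below m)"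
      by (rule has_sum_cmult_left) (rule M)
    fix \<alpha> assume \<alpha>: "\<alpha> \<in> ?A - monomials_below m"
    have "(\<Prod>i\<in>I. norm (\<xi> i x - \<xi> i a) ^ \<alpha> i) \<le> (\<Prod>i\<in>I. norm (x - a) ^ \<alpha> i)"
      by (intro prod_mono conjI power_mono coord_le) auto
    then have "norm (t x \<alpha>) \<le> norm (c \<alpha>) * norm (x - a) ^ sum \<alpha> I"
      by (simp add: t_def norm_mult prod_norm[symmetric] norm_power power_sum mult_left_mono)
    also have "\<dots> = w \<alpha> * (norm (x - a) / \<rho>) ^ sum \<alpha> I"
      using \<rho> by (simp add: w_def power_divide)
    \<comment> \<open>Here the quotient is at most 1 and the degree of \<alpha> is at least m, so
      lowering the exponent to m can only increase the power.\<close>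
    also have "\<dots> \<le> w \<alpha> * (norm (x - a) / \<rho>) ^ m"
      using \<alpha> x \<rho> w_nonneg
      by (intro mult_left_mono power_decreasing) (auto simp: dist_norm norm_minus_commute)
    finally show "norm (t x \<alpha>) \<le> w \<alpha> * (norm (x - a) / \<rho>) ^ m" .
  qed
  moreover have "\<forall>\<^sub>F x in nhds a. x \<in> ball a \<rho>"
    using \<rho> by (intro eventually_nhds_in_open) auto
  ultimately have "\<forall>\<^sub>F x in nhds a. norm (f x - (\<Sum>\<alpha>\<in>monomials_below m. t x \<alpha>)) \<le> M / \<rho> ^ m * norm (x - a) ^ m"
    by (auto simp: power_divide elim: eventually_mono)
  moreover have "M / \<rho> ^ m \<ge> 0"
    using \<rho> \<open>M \<ge> 0\<close> by simp
  ultimately show ?thesis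
    unfolding t_def by blast
qed

lemma lipschitz_at_point:
  assumes "power_series_at \<xi> I c f a"
  shows "\<exists>C\<ge>0. \<forall>\<^sub>F x in nhds a. norm (f x - f a) \<le> C * norm (x - a)"
proof -
  let ?p = "\<lambda>x. \<Sum>\<alpha>\<in>monomials_below 1. c \<alpha> * (\<Prod>i\<in>I. (\<xi> i x - \<xi> i a) ^ \<alpha> i)"
  obtain C where C: "C \<ge> 0" "\<forall>\<^sub>F x in nhds a. norm (f x - ?p x) \<le> C * norm (x - a) ^ 1"
    using taylor_remainder[OF assms, of 1] by blast
  \<comment> \<open>Below degree 1 only the zero exponent remains, so the Taylor polynomial is
    constant.\<close>
  have const: "?p x = ?p a" for x
    using finite_index by (intro sum.cong arg_cong2[where f = "(*)"] prod.cong) auto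
  \<comment> \<open>The remainder estimate also holds at \<open>x = a\<close>, where its right-hand
    side is 0.\<close>
  have "f a = ?p a"
    using eventually_nhds_x_imp_x[OF C(2)] by simp
  with C const show ?thesis
    by (intro exI[of _ C]) simp
qed

end

section \<open>Uniqueness of coefficients and order of vanishing along lines\<close>

text \<open>Multi-indices in \<open>A\<close> may have arbitrary values outside \<open>I\<close>; only their restrictions must be
  distinct, so that the induction on \<open>I\<close> needs no reindexing.\<close>

lemma polynomial_eq_zeroD:
  fixes c :: "('i \<Rightarrow> nat) \<Rightarrow> 'k::field_char_0"
  assumes "finite I" "finite A" "inj_on (\<lambda>\<alpha>. restrict \<alpha> I) A"
    and "\<And>v. (\<Sum>\<alpha>\<in>A. c \<alpha> * (\<Prod>i\<in>I. v i ^ \<alpha> i)) = 0" and "\<alpha> \<in> A"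
  shows "c \<alpha> = 0"
  using assms
proof (induction I arbitrary: A rule: finite_induct)
  case empty
  then have "A = {\<alpha>}"
    by (auto simp: inj_on_def)
  with empty(3)[of undefined] show ?case by simp
next
  case (insert i I)
  \<comment> \<open>With the variables in \<open>I\<close> frozen, the sum is a polynomial in the
    variable \<open>i\<close> that vanishes identically. Its coefficient at exponent
    \<open>\<alpha> i\<close> is the sum over \<open>B\<close>, to which the induction hypothesis
    applies.\<close>
  define B where "B = {\<beta> \<in> A. \<beta> i = \<alpha> i}"
  show ?case
  proof (rule insert.IH[of B])
    show "finite B" "\<alpha> \<in> B"
      using insert.prems by (auto simp: B_def)
    show "inj_on (\<lambda>\<alpha>. restrict \<alpha> I) B"
    proof (rule inj_onI)
      fix \<beta> \<gamma> assume \<beta>\<gamma>: "\<beta> \<in> B" "\<gamma> \<in> B" "restrict \<beta> I = restrict \<gamma> I"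
      then have "restrict \<beta> (insert i I) = restrict \<gamma> (insert i I)"
        by (auto simp: B_def restrict_def fun_eq_iff split: if_splits)
      with inj_onD[OF insert.prems(2), of \<beta> \<gamma>] \<beta>\<gamma> show "\<beta> = \<gamma>"
        by (auto simp: B_def)
    qed
    fix v :: "'i \<Rightarrow> 'k"
    define p where "p = (\<Sum>\<beta>\<in>A. monom (c \<beta> * (\<Prod>j\<in>I. v j ^ \<beta> j)) (\<beta> i))"
    have "poly p x = 0" for x
    proof -
      have "poly p x = (\<Sum>\<beta>\<in>A. c \<beta> * (\<Prod>j\<in>insert i I. (v(i := x)) j ^ \<beta> j))"
        unfolding p_def poly_sum poly_monom
      proof (intro sum.cong refl)
        fix \<beta>
        have "(\<Prod>j\<in>I. (v(i := x)) j ^ \<beta> j) = (\<Prod>j\<in>I. v j ^ \<beta> j)"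
          using insert.hyps by (intro prod.cong) auto
        then show "c \<beta> * (\<Prod>j\<in>I. v j ^ \<beta> j) * x ^ \<beta> i =
            c \<beta> * (\<Prod>j\<in>insert i I. (v(i := x)) j ^ \<beta> j)"
          using insert.hyps by (simp add: mult_ac)
      qed
      then show ?thesis
        using insert.prems(3) by simp
    qed
    then have "coeff p (\<alpha> i) = 0"
      using poly_all_0_iff_0[of p] by simp
    moreover have "coeff p (\<alpha> i) = (\<Sum>\<beta>\<in>B. c \<beta> * (\<Prod>j\<in>I. v j ^ \<beta> j))"
      unfolding p_def coeff_sum B_def
      using insert.prems(1) by (simp add: sum.If_cases Int_def eq_commute)
    ultimately show "(\<Sum>\<beta>\<in>B. c \<beta> * (\<Prod>j\<in>I. v j ^ \<beta> j)) = 0" by simp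
  qed
qed

interpretation cart: coordinates "\<lambda>i (x::'k::real_or_complex^'n). x $ i" "UNIV :: 'n set"
proof
  fix a :: "'k^'n" and \<rho>
  show "\<exists>x. \<forall>i\<in>UNIV. x $ i - a $ i = of_real \<rho>"
    by (intro exI[of _ "\<chi> i. a $ i + of_real \<rho>"]) simp
qed (auto simp flip: vector_minus_component simp: Finite_Cartesian_Product.norm_nth_le)

interpretation basis: coordinates "\<lambda>e (x::'a::euclidean_space). x \<bullet> e" "Basis :: 'a set"
proof
  fix a :: 'a and \<rho>
  show "\<exists>x. \<forall>e\<in>Basis. x \<bullet> e - a \<bullet> e = of_real \<rho>"
    by (intro exI[of _ "a + (\<Sum>e\<in>Basis. \<rho> *\<^sub>R e)"]) (simp add: inner_left_distrib)
qed (auto simp flip: inner_diff_left simp: Basis_le_norm)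

text \<open>Induction on the degree k of \<alpha>: once all coefficients of lower degree vanish, f
  along a line is the homogeneous part P of degree k, scaled by the k-th power of the parameter, up
  to an error of order k + 1. Since k < m, the growth bound forces P to vanish in every direction,
  hence all its coefficients vanish. The speed \<epsilon> may depend on v, so that a line need only
  be followed for a short time.\<close>

lemma coeff_eq_zero_if_vanishing_on_lines:
  fixes f :: "'k::real_or_complex^'n \<Rightarrow> 'k"
  assumes "power_series_at (\<lambda>i x. x $ i) UNIV c f p"
    and lines: "\<And>v. \<exists>\<epsilon>>0. \<exists>C. \<forall>\<^sub>F s in at_right 0. norm (f (p + (s * \<epsilon>) *\<^sub>R v)) \<le> C * s ^ m"
    and "sum \<alpha> UNIV < m"
  shows "c \<alpha> = 0"
  using assms(3)
proof (induction "sum \<alpha> UNIV" arbitrary: \<alpha> rule: less_induct)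
  case (less \<alpha>)
  define k where "k = sum \<alpha> UNIV"
  define A where "A = {\<beta> :: 'n \<Rightarrow> nat. sum \<beta> UNIV = k}"
  define P where "P v = (\<Sum>\<beta>\<in>A. c \<beta> * (\<Prod>i\<in>UNIV. v $ i ^ \<beta> i))" for v
  have A: "A \<subseteq> cart.monomials_below (Suc k)"
    by (auto simp: A_def)
  have finA: "finite A"
    by (rule finite_subset[OF A cart.finite_monomials_below])
  have P_zero: "P v = 0" for v
  proof -
    obtain \<epsilon> C where \<epsilon>: "\<epsilon> > 0"
      and C: "\<forall>\<^sub>F s in at_right 0. norm (f (p + (s * \<epsilon>) *\<^sub>R v)) \<le> C * s ^ m"
      using lines[of v] by blast
    obtain C' where "C' \<ge> 0" and C': "\<forall>\<^sub>F x in nhds p. norm (f x - (\<Sum>\<beta>\<in>cart.monomials_below (Suc k).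
        c \<beta> * (\<Prod>i\<in>UNIV. (x $ i - p $ i) ^ \<beta> i))) \<le> C' * norm (x - p) ^ Suc k"
      using cart.taylor_remainder[OF assms(1)] by blast
    have "((\<lambda>s. p + (s * \<epsilon>) *\<^sub>R v) \<longlongrightarrow> p + (0 * \<epsilon>) *\<^sub>R v) (at_right 0)"
      by (intro tendsto_intros)
    then have "\<forall>\<^sub>F s in at_right 0. norm (f (p + (s * \<epsilon>) *\<^sub>R v) - (\<Sum>\<beta>\<in>cart.monomials_below (Suc k).
        c \<beta> * (\<Prod>i\<in>UNIV. ((p + (s * \<epsilon>) *\<^sub>R v) $ i - p $ i) ^ \<beta> i)))
        \<le> C' * norm (p + (s * \<epsilon>) *\<^sub>R v - p) ^ Suc k"
      by (intro eventually_compose_filterlim[OF C']) simp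
    moreover have "(\<Sum>\<beta>\<in>cart.monomials_below (Suc k).
        c \<beta> * (\<Prod>i\<in>UNIV. ((p + (s * \<epsilon>) *\<^sub>R v) $ i - p $ i) ^ \<beta> i)) = of_real (s * \<epsilon>) ^ k * P v" for s
    proof -
      have "c \<beta> * (\<Prod>i\<in>UNIV. ((p + (s * \<epsilon>) *\<^sub>R v) $ i - p $ i) ^ \<beta> i) =
          of_real (s * \<epsilon>) ^ sum \<beta> UNIV * (c \<beta> * (\<Prod>i\<in>UNIV. v $ i ^ \<beta> i))" for \<beta>
        by (simp add: scaleR_conv_of_real[where 'a='k] power_mult_distrib prod.distrib power_sum mult_ac)
      moreover have "c \<beta> = 0" if "\<beta> \<in> cart.monomials_below (Suc k) - A" for \<beta>
        using less.hyps[of \<beta>] that less.prems by (auto simp: A_def k_def)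
      ultimately have "(\<Sum>\<beta>\<in>cart.monomials_below (Suc k).
          c \<beta> * (\<Prod>i\<in>UNIV. ((p + (s * \<epsilon>) *\<^sub>R v) $ i - p $ i) ^ \<beta> i)) =
          (\<Sum>\<beta>\<in>A. of_real (s * \<epsilon>) ^ sum \<beta> UNIV * (c \<beta> * (\<Prod>i\<in>UNIV. v $ i ^ \<beta> i)))"
        using A by (intro sum.mono_neutral_cong_right cart.finite_monomials_below) auto
      also have "\<dots> = of_real (s * \<epsilon>) ^ k * P v"
        unfolding P_def sum_distrib_left by (intro sum.cong) (auto simp: A_def)
      finally show ?thesis .
    qed
    ultimately have R: "\<forall>\<^sub>F s in at_right 0. norm (f (p + (s * \<epsilon>) *\<^sub>R v) - of_real (s * \<epsilon>) ^ k * P v)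
        \<le> C' * norm (p + (s * \<epsilon>) *\<^sub>R v - p) ^ Suc k"
      by simp
    \<comment> \<open>After division by the k-th power of s, this constant times s bounds the
      leading part; it collects the growth bound and the Taylor remainder. The absolute value is
      taken because the sign of \<open>C\<close> is unknown.\<close>
    define K where "K = \<bar>C\<bar> + C' * (\<epsilon> * norm v) ^ Suc k"
    have "\<forall>\<^sub>F s in at_right (0::real). s \<in> {0<..<1}"
      by (rule eventually_at_right_real) simp
    with C R have "\<forall>\<^sub>F s in at_right 0. \<epsilon> ^ k * norm (P v) \<le> K * s"
    proof eventually_elim
      case (elim s)
      then have s: "0 < s" "s < 1" by auto
      have "s ^ k * (\<epsilon> ^ k * norm (P v)) = norm (of_real (s * \<epsilon>) ^ k * P v)"
        using s \<epsilon> by (simp add: norm_mult norm_power power_mult_distrib)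
      also have "\<dots> \<le> norm (f (p + (s * \<epsilon>) *\<^sub>R v)) +
          norm (f (p + (s * \<epsilon>) *\<^sub>R v) - of_real (s * \<epsilon>) ^ k * P v)"
        by (metis norm_minus_commute norm_triangle_sub)
      also have "\<dots> \<le> C * s ^ m + C' * (s * \<epsilon> * norm v) ^ Suc k"
        using elim s \<epsilon> by (intro add_mono) auto
      also have "\<dots> \<le> \<bar>C\<bar> * s ^ Suc k + C' * (s * \<epsilon> * norm v) ^ Suc k"
        using s less.prems by (intro add_right_mono mult_mono power_decreasing) (auto simp: k_def)
      also have "\<dots> = s ^ k * (K * s)"
        by (simp add: K_def power_mult_distrib algebra_simps)
      finally show ?case
        using s by simp
    qed
    \<comment> \<open>The left-hand side of the bound does not depend on s, so letting s tend to 0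
      makes it nonpositive.\<close>
    moreover have "((\<lambda>s. K * s) \<longlongrightarrow> K * 0) (at_right 0)"
      by (intro tendsto_intros)
    ultimately have "\<epsilon> ^ k * norm (P v) \<le> K * 0"
      by (intro tendsto_lowerbound[of "\<lambda>s. K * s"]) auto
    then show ?thesis
      using zero_less_power[OF \<epsilon>, of k] by (auto simp: mult_le_0_iff)
  qed
  have vanish: "(\<Sum>\<beta>\<in>A. c \<beta> * (\<Prod>i\<in>UNIV. v i ^ \<beta> i)) = 0" for v
    using P_zero[of "vec_lambda v"] by (simp add: P_def)
  show "c \<alpha> = 0"
    by (rule polynomial_eq_zeroD[where I = UNIV and A = A and c = c and \<alpha> = \<alpha>, OF finite finA _ vanish])
      (auto simp: A_def k_def inj_on_def restrict_def)
qed

text \<open>Two expansions of the same germ differ by an expansion of the zero function, which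
  vanishes to every order on every line; so the description by \<open>THE\<close> is well
  defined.\<close>

lemma taylor_coeff_eq:
  fixes f :: "'k::real_or_complex^'n \<Rightarrow> 'k"
  assumes "power_series_at (\<lambda>i x. x $ i) UNIV c f p"
  shows "taylor_coeff f p = c"
  unfolding taylor_coeff_def
proof (rule the_equality)
  fix c' assume "power_series_at (\<lambda>i x. x $ i) UNIV c' f p"
  then obtain r where r: "r > 0" "\<And>x. x \<in> polydisc (\<lambda>i x. x $ i) UNIV p r \<Longrightarrow>
      ((\<lambda>\<alpha>. c' \<alpha> * (\<Prod>i\<in>UNIV. (x $ i - p $ i) ^ \<alpha> i)) has_sum f x) (UNIV \<rightarrow>\<^sub>E UNIV)"
    unfolding power_series_at_def by blast
  obtain r' where r': "r' > 0" "\<And>x. x \<in> polydisc (\<lambda>i x. x $ i) UNIV p r' \<Longrightarrow>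
      ((\<lambda>\<alpha>. c \<alpha> * (\<Prod>i\<in>UNIV. (x $ i - p $ i) ^ \<alpha> i)) has_sum f x) (UNIV \<rightarrow>\<^sub>E UNIV)"
    using assms unfolding power_series_at_def by blast
  have "power_series_at (\<lambda>i x. x $ i) UNIV (\<lambda>\<alpha>. c' \<alpha> - c \<alpha>) (\<lambda>x. 0) p"
    unfolding power_series_at_def
  proof (intro exI[of _ "min r r'"] conjI ballI)
    fix x assume "x \<in> polydisc (\<lambda>i x. x $ i) UNIV p (min r r')"
    then have "x \<in> polydisc (\<lambda>i x. x $ i) UNIV p r" "x \<in> polydisc (\<lambda>i x. x $ i) UNIV p r'"
      by (auto simp: polydisc_def)
    from has_sum_add[OF r(2)[OF this(1)] has_sum_uminusI[OF r'(2)[OF this(2)]]]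
    show "((\<lambda>\<alpha>. (c' \<alpha> - c \<alpha>) * (\<Prod>i\<in>UNIV. (x $ i - p $ i) ^ \<alpha> i)) has_sum 0) (UNIV \<rightarrow>\<^sub>E UNIV)"
      by (simp add: left_diff_distrib)
  qed (use r(1) r'(1) in auto)
  then have "c' \<alpha> - c \<alpha> = 0" for \<alpha>
    by (rule coeff_eq_zero_if_vanishing_on_lines[where m = "Suc (sum \<alpha> UNIV)"])
      (rule exI[of _ "1::real"], simp, rule exI[of _ "0::real"], simp_all)
  then show "c' = c" by auto
qed (rule assms)

lemma enat_le_mult_at_iff:
  fixes f :: "'k::real_or_complex^'n \<Rightarrow> 'k"
  assumes "power_series_at (\<lambda>i x. x $ i) UNIV c f p"
  shows "enat m \<le> mult_at p f \<longleftrightarrow> (\<forall>\<alpha>. sum \<alpha> UNIV < m \<longrightarrow> c \<alpha> = 0)"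
  unfolding mult_at_def taylor_coeff_eq[OF assms] by (simp add: le_INF_iff) (rule all_cong1, auto)

lemma mult_at_growth:
  fixes f :: "'k::real_or_complex^'n \<Rightarrow> 'k"
  assumes "coord_analytic_at (\<lambda>i x. x $ i) UNIV f p" "enat m \<le> mult_at p f"
  shows "\<exists>C\<ge>0. \<forall>\<^sub>F x in nhds p. norm (f x) \<le> C * norm (x - p) ^ m"
proof -
  obtain c where c: "power_series_at (\<lambda>i x. x $ i) UNIV c f p"
    using assms(1) by (auto simp: coord_analytic_at_def)
  then have "c \<alpha> = 0" if "\<alpha> \<in> cart.monomials_below m" for \<alpha>
    using enat_le_mult_at_iff[OF c] assms(2) that by auto
  then show ?thesis
    using cart.taylor_remainder[OF c, of m] by simp
qed

text \<open>Together with \<open>mult_at_growth\<close> this turns multiplicity into a growth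
  condition, so power series need not be composed with the trivialization.\<close>

lemma enat_le_mult_at_if_vanishing_on_lines:
  fixes f :: "'k::real_or_complex^'n \<Rightarrow> 'k"
  assumes "coord_analytic_at (\<lambda>i x. x $ i) UNIV f p"
    and "\<And>v. \<exists>\<epsilon>>0. \<exists>C. \<forall>\<^sub>F s in at_right 0. norm (f (p + (s * \<epsilon>) *\<^sub>R v)) \<le> C * s ^ m"
  shows "enat m \<le> mult_at p f"
proof -
  obtain c where c: "power_series_at (\<lambda>i x. x $ i) UNIV c f p"
    using assms(1) by (auto simp: coord_analytic_at_def)
  show ?thesis
    unfolding enat_le_mult_at_iff[OF c]
    using coeff_eq_zero_if_vanishing_on_lines[OF c assms(2)] by blast
qed

section \<open>Real analytic maps and straight arcs\<close>

text \<open>The first-order remainder estimate is applied to each coordinate of f, and the finitely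
  many constants are added.\<close>

lemma real_analytic_on_lipschitz_at:
  assumes "real_analytic_on U f" "a \<in> U"
  shows "\<exists>C\<ge>0. \<forall>\<^sub>F x in nhds a. norm (f x - f a) \<le> C * norm (x - a)"
proof -
  have "\<forall>b\<in>Basis. \<exists>C\<ge>0. \<forall>\<^sub>F x in nhds a. norm (f x \<bullet> b - f a \<bullet> b) \<le> C * norm (x - a)"
    using assms basis.lipschitz_at_point
    unfolding real_analytic_on_def coord_analytic_at_def by blast
  from bchoice[OF this] obtain C where C: "\<And>b. b \<in> Basis \<Longrightarrow> C b \<ge> 0"
    "\<And>b. b \<in> Basis \<Longrightarrow> \<forall>\<^sub>F x in nhds a. norm (f x \<bullet> b - f a \<bullet> b) \<le> C b * norm (x - a)"
    by blast
  have "\<forall>\<^sub>F x in nhds a. \<forall>b\<in>Basis. norm (f x \<bullet> b - f a \<bullet> b) \<le> C b * norm (x - a)"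
    using C(2) by (intro eventually_ball_finite) auto
  then have "\<forall>\<^sub>F x in nhds a. norm (f x - f a) \<le> (\<Sum>b\<in>Basis. C b) * norm (x - a)"
  proof (rule eventually_mono)
    fix x assume "\<forall>b\<in>Basis. norm (f x \<bullet> b - f a \<bullet> b) \<le> C b * norm (x - a)"
    then have "(\<Sum>b\<in>Basis. \<bar>(f x - f a) \<bullet> b\<bar>) \<le> (\<Sum>b\<in>Basis. C b * norm (x - a))"
      by (intro sum_mono) (auto simp: inner_diff_left)
    then show "norm (f x - f a) \<le> (\<Sum>b\<in>Basis. C b) * norm (x - a)"
      using norm_le_l1[of "f x - f a"] by (simp add: sum_distrib_right)
  qed
  then show ?thesis
    using C(1) by (intro exI[of _ "\<Sum>b\<in>Basis. C b"]) (auto intro: sum_nonneg)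
qed

lemma real_analytic_on_tendsto:
  assumes "real_analytic_on U f" "a \<in> U"
  shows "(f \<longlongrightarrow> f a) (nhds a)"
proof -
  obtain C where "\<forall>\<^sub>F x in nhds a. norm (f x - f a) \<le> C * norm (x - a)"
    using real_analytic_on_lipschitz_at[OF assms] by blast
  moreover have "((\<lambda>x. C * norm (x - a)) \<longlongrightarrow> 0) (nhds a)"
  proof -
    have "((\<lambda>x. C * norm (x - a)) \<longlongrightarrow> C * norm (a - a)) (nhds a)"
      by (intro tendsto_intros filterlim_ident)
    then show ?thesis by simp
  qed
  ultimately have "((\<lambda>x. f x - f a) \<longlongrightarrow> 0) (nhds a)"
    by (rule Lim_null_comparison)
  then show ?thesis
    by (rule LIM_zero_cancel)
qed

lemma real_analytic_on_line:
  fixes p v :: "'a::euclidean_space"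
  shows "real_analytic_on S (\<lambda>s. p + (s * \<epsilon>) *\<^sub>R v)"
  unfolding real_analytic_on_def
proof (intro ballI)
  fix a :: real and b :: 'a
  \<comment> \<open>The basis of the reals is \<open>{1}\<close>, so a multi-index is determined by
    its value at 1 and is \<open>undefined\<close> elsewhere. The affine expansion has only the
    terms \<open>e 0\<close> and \<open>e 1\<close>.\<close>
  define e where "e k = (\<lambda>x\<in>{1::real}. k :: nat)" for k
  define c where "c \<alpha> = (if \<alpha> 1 = 0 then (p + (a * \<epsilon>) *\<^sub>R v) \<bullet> b else if \<alpha> 1 = 1 then \<epsilon> * (v \<bullet> b) else 0)"
    for \<alpha> :: "real \<Rightarrow> nat"
  have "((\<lambda>\<alpha>. c \<alpha> * (x - a) ^ \<alpha> 1) has_sum (p + (x * \<epsilon>) *\<^sub>R v) \<bullet> b) ({1} \<rightarrow>\<^sub>E UNIV)" for x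
  proof (rule has_sum_finite_neutralI[of "{e 0, e 1}"])
    have e_1: "e k 1 = k" for k
      by (simp add: e_def)
    have ne: "e 0 \<noteq> e 1"
      by (metis e_1 zero_neq_one)
    have "(\<Sum>\<alpha>\<in>{e 0, e 1}. c \<alpha> * (x - a) ^ \<alpha> 1) = c (e 0) * (x - a) ^ e 0 1 + c (e 1) * (x - a) ^ e 1 1"
      using ne by simp
    also have "\<dots> = (p + (a * \<epsilon>) *\<^sub>R v) \<bullet> b + \<epsilon> * (v \<bullet> b) * (x - a)"
      unfolding c_def e_1 by simp
    also have "\<dots> = (p + (x * \<epsilon>) *\<^sub>R v) \<bullet> b"
      unfolding inner_add_left inner_scaleR_left by (simp add: field_simps)
    finally show "(p + (x * \<epsilon>) *\<^sub>R v) \<bullet> b = (\<Sum>\<alpha>\<in>{e 0, e 1}. c \<alpha> * (x - a) ^ \<alpha> 1)"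
      by (rule sym)
    fix \<alpha> assume \<alpha>: "\<alpha> \<in> ({1} \<rightarrow>\<^sub>E UNIV) - {e 0, e 1}"
    then have "e (\<alpha> 1) x = \<alpha> x" for x
      using PiE_arb[of \<alpha> "{1}" "\<lambda>_. UNIV" x] by (cases "x = 1") (auto simp: e_def)
    then have "e (\<alpha> 1) = \<alpha>"
      by (rule ext)
    with \<alpha> have "\<alpha> 1 \<noteq> 0" "\<alpha> 1 \<noteq> 1"
      by (metis Diff_iff insertCI)+
    then show "c \<alpha> * (x - a) ^ \<alpha> 1 = 0"
      by (simp add: c_def)
  qed (auto simp: e_def)
  then show "coord_analytic_at (\<lambda>e x. x \<bullet> e) Basis (\<lambda>s. (p + (s * \<epsilon>) *\<^sub>R v) \<bullet> b) a"
    unfolding coord_analytic_at_def power_series_at_def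
    by (intro exI[of _ c] exI[of _ 1]) auto
qed

lemma real_analytic_on_snd:
  assumes "real_analytic_on U f"
  shows "real_analytic_on U (\<lambda>x. snd (f x))"
  unfolding real_analytic_on_def
proof (intro ballI)
  fix a :: 'a and b :: 'c assume ab: "a \<in> U" "b \<in> Basis"
  have "(0, b) \<in> Basis"
    using ab by (simp add: Basis_prod_def)
  then have "coord_analytic_at (\<lambda>e x. x \<bullet> e) Basis (\<lambda>x. f x \<bullet> (0, b)) a"
    using assms ab unfolding real_analytic_on_def by blast
  then show "coord_analytic_at (\<lambda>e x. x \<bullet> e) Basis (\<lambda>x. snd (f x) \<bullet> b) a"
    by (simp add: inner_prod_def)
qed

section \<open>Restriction to the fibres of the projection\<close>

lemma join_vec_std_proj_fibre_coord: "join_vec (std_proj y) (fibre_coord y) = y"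
  by (simp add: join_vec_def std_proj_def fibre_coord_def vec_eq_iff split: sum.split)

lemma join_vec_add_scaleR: "join_vec t (x + s *\<^sub>R v) = join_vec t x + s *\<^sub>R join_vec 0 v"
  by (simp add: join_vec_def vec_eq_iff split: sum.split)

lemma bounded_linear_fibre_coord:
  "bounded_linear (fibre_coord :: 'k::real_or_complex^('m::finite + 'n::finite) \<Rightarrow> 'k^'n)"
  by (intro linear_conv_bounded_linear[THEN iffD1] linearI) (auto simp: fibre_coord_def vec_eq_iff)

text \<open>On the fibre, the increments of the base coordinates are 0, so exactly the monomials in
  the fibre variables survive.\<close>

lemma fibre_restrict_analytic_at:
  fixes f :: "'k::real_or_complex^('m::finite + 'n::finite) \<Rightarrow> 'k"
  assumes "coord_analytic_at (\<lambda>i x. x $ i) UNIV f (join_vec t x)"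
  shows "coord_analytic_at (\<lambda>i x. x $ i) UNIV (fibre_restrict f t) x"
proof -
  obtain c r where r: "r > 0" "\<And>y. y \<in> polydisc (\<lambda>i x. x $ i) UNIV (join_vec t x) r \<Longrightarrow>
      ((\<lambda>\<alpha>. c \<alpha> * (\<Prod>i\<in>UNIV. (y $ i - join_vec t x $ i) ^ \<alpha> i)) has_sum f y) UNIV"
    using assms unfolding coord_analytic_at_def power_series_at_def by auto
  \<comment> \<open>Extension of a multi-index by 0 in the base variables; its range indexes the
    surviving terms.\<close>
  define h where "h \<beta> = case_sum (\<lambda>_ :: 'm. 0 :: nat) \<beta>" for \<beta> :: "'n \<Rightarrow> nat"
  have h: "inj h"
    by (auto simp: inj_def h_def fun_eq_iff split: sum.splits)
  have "((\<lambda>\<beta>. c (h \<beta>) * (\<Prod>i\<in>UNIV. (x' $ i - x $ i) ^ \<beta> i)) has_sum fibre_restrict f t x') UNIV"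
    if x': "x' \<in> polydisc (\<lambda>i x. x $ i) UNIV x r" for x'
  proof -
    define g where "g \<alpha> = c \<alpha> * (\<Prod>i\<in>UNIV. (join_vec t x' $ i - join_vec t x $ i) ^ \<alpha> i)" for \<alpha>
    have "join_vec t x' \<in> polydisc (\<lambda>i x. x $ i) UNIV (join_vec t x) r"
      using x' r(1) by (auto simp: polydisc_def join_vec_def split: sum.split)
    then have "(g has_sum fibre_restrict f t x') UNIV"
      unfolding g_def fibre_restrict_def by (rule r(2))
    also have "(g has_sum fibre_restrict f t x') UNIV \<longleftrightarrow> (g has_sum fibre_restrict f t x') (range h)"
    proof (rule has_sum_cong_neutral)
      fix \<alpha> assume "\<alpha> \<in> UNIV - range h"
      then have "\<alpha> \<noteq> h (\<alpha> \<circ> Inr)"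
        by auto
      then obtain i where "\<alpha> i \<noteq> h (\<alpha> \<circ> Inr) i"
        by blast
      then obtain j where "\<alpha> (Inl j) \<noteq> 0"
        by (cases i) (auto simp: h_def)
      then have "\<exists>i. (join_vec t x' $ i - join_vec t x $ i) ^ \<alpha> i = 0"
        by (intro exI[of _ "Inl j"]) (simp add: join_vec_def)
      then show "g \<alpha> = 0"
        unfolding g_def by (simp add: prod_zero_iff)
    qed auto
    also have "\<dots> \<longleftrightarrow> ((g \<circ> h) has_sum fibre_restrict f t x') UNIV"
      by (rule has_sum_reindex[OF h])
    also have "g \<circ> h = (\<lambda>\<beta>. c (h \<beta>) * (\<Prod>i\<in>UNIV. (x' $ i - x $ i) ^ \<beta> i))"
      unfolding UNIV_Plus_UNIV[symmetric] g_def comp_def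
      by (subst prod.Plus) (auto simp: h_def join_vec_def)
    finally show ?thesis .
  qed
  then show ?thesis
    unfolding coord_analytic_at_def power_series_at_def using r(1)
    by (intro exI[of _ "\<lambda>\<beta>. c (h \<beta>)"] exI[of _ r]) auto
qed

text \<open>A line in the fibre is a line in the total space with direction
  \<open>join_vec 0 v\<close>, so the growth bound for f restricts to it.\<close>

lemma mult_at_le_mult_at_fibre_restrict:
  fixes f :: "'k::real_or_complex^('m::finite + 'n::finite) \<Rightarrow> 'k"
  assumes f: "coord_analytic_at (\<lambda>i x. x $ i) UNIV f (join_vec t x)"
    and m: "enat m \<le> mult_at (join_vec t x) f"
  shows "enat m \<le> mult_at x (fibre_restrict f t)"
proof (rule enat_le_mult_at_if_vanishing_on_lines)
  fix v :: "'k^'n"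
  let ?w = "join_vec 0 v :: 'k^('m + 'n)"
  obtain C where C: "\<forall>\<^sub>F y in nhds (join_vec t x). norm (f y) \<le> C * norm (y - join_vec t x) ^ m"
    using mult_at_growth[OF f m] by blast
  have "((\<lambda>s. join_vec t x + s *\<^sub>R ?w) \<longlongrightarrow> join_vec t x + 0 *\<^sub>R ?w) (at_right 0)"
    by (intro tendsto_intros)
  then have "\<forall>\<^sub>F s in at_right 0. norm (f (join_vec t x + s *\<^sub>R ?w)) \<le> C * norm (join_vec t x + s *\<^sub>R ?w - join_vec t x) ^ m"
    by (intro eventually_compose_filterlim[OF C]) simp
  moreover have "\<forall>\<^sub>F s in at_right (0::real). s > 0"
    by (simp add: eventually_at_right_less)
  ultimately have "\<forall>\<^sub>F s in at_right 0. norm (fibre_restrict f t (x + (s * 1) *\<^sub>R v)) \<le> C * norm ?w ^ m * s ^ m"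
    by eventually_elim (simp add: fibre_restrict_def join_vec_add_scaleR power_mult_distrib mult_ac)
  then show "\<exists>\<epsilon>>0. \<exists>C. \<forall>\<^sub>F s in at_right 0. norm (fibre_restrict f t (x + (s * \<epsilon>) *\<^sub>R v)) \<le> C * s ^ m"
    using zero_less_one by blast
qed (rule fibre_restrict_analytic_at[OF f])

text \<open>Lets multiplicities be compared through finite lower bounds only, which also covers
  germs of infinite multiplicity.\<close>

lemma le_if_all_enat_le: "x \<le> y" if "\<And>m. enat m \<le> x \<Longrightarrow> enat m \<le> y"
proof (cases x)
  case (enat k)
  with that show ?thesis by simp
next
  case infinity
  then have "enat m \<le> y" for m
    using that by simp
  then have "enat (Suc k) \<le> y" for k .
  then show ?thesis
    by (metis Suc_n_not_le_n enat.exhaust enat_ord_code(3) enat_ord_simps(1))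
qed

section \<open>Multiplicities along an arc-wise analytic trivialization\<close>

lemma arcwise_analytic_trivializationD:
  assumes "arcwise_analytic_trivialization T Z Y \<Phi>"
  shows "homeomorphism (T \<times> Z) Y \<Phi> (inv_into (T \<times> Z) \<Phi>)"
    and "analytic_arc_in Z z \<Longrightarrow> real_analytic_on (T \<times> {-1<..<1}) (\<lambda>(t, s). \<Phi> (t, z s))"
    and "t \<in> T \<Longrightarrow> x \<in> Z \<Longrightarrow> std_proj (\<Phi> (t, x)) = t"
    and "arc_analytic_on Y (inv_into (T \<times> Z) \<Phi>)"
  by (use assms[unfolded arcwise_analytic_trivialization_def Let_def, THEN conjunct1, THEN conjunct1] in simp)
    (use assms[unfolded arcwise_analytic_trivialization_def Let_def, THEN conjunct2, THEN conjunct1] in simp,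
     use assms[unfolded arcwise_analytic_trivialization_def Let_def, THEN conjunct2, THEN conjunct2, THEN conjunct1] in simp,
     use assms[unfolded arcwise_analytic_trivialization_def Let_def, THEN conjunct2, THEN conjunct2, THEN conjunct2, THEN conjunct1] in simp)

text \<open>The bound \<open>K\<close> must be uniform over all pairs of parameters in
  \<open>T'\<close>: a line through \<open>\<Phi> (t', z0)\<close> crosses varying fibres, and each
  of its points is compared with the point of the one fibre over \<open>t\<close> having the same
  Z-component.\<close>

lemma mult_at_fibre_restrict_le_mult_at:
  fixes T T' :: "('k::real_or_complex^'m) set" and Z Z' :: "('k^'n) set"
    and Y :: "('k^('m::finite + 'n::finite)) set"
  assumes Y: "open Y" and triv: "arcwise_analytic_trivialization T Z Y \<Phi>"
    and T': "open T'" "T' \<subseteq> T" and Z': "open Z'" "Z' \<subseteq> Z"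
    and f: "\<And>t z. t \<in> T' \<Longrightarrow> z \<in> Z' \<Longrightarrow> coord_analytic_at (\<lambda>i x. x $ i) UNIV f (\<Phi> (t, z))"
    and regular: "\<And>t t' z. t \<in> T' \<Longrightarrow> t' \<in> T' \<Longrightarrow> z \<in> Z' \<Longrightarrow>
      norm (f (\<Phi> (t', z))) \<le> K * norm (f (\<Phi> (t, z)))"
    and t: "t \<in> T'" "t' \<in> T'" and z0: "z0 \<in> Z'"
    and m: "enat m \<le> mult_at (fibre_coord (\<Phi> (t, z0))) (fibre_restrict f t)"
  shows "enat m \<le> mult_at (\<Phi> (t', z0)) f"
proof -
  let ?I = "{-1<..<1::real}"
  define \<Psi> where "\<Psi> = inv_into (T \<times> Z) \<Phi>"
  note hom = arcwise_analytic_trivializationD(1)[OF triv, folded \<Psi>_def]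
    and arc = arcwise_analytic_trivializationD(2)[OF triv]
    and proj = arcwise_analytic_trivializationD(3)[OF triv]
    and arc_inv = arcwise_analytic_trivializationD(4)[OF triv, folded \<Psi>_def]
  have \<Psi>: "\<Psi> y \<in> T \<times> Z" "\<Phi> (\<Psi> y) = y" if "y \<in> Y" for y
    using hom that unfolding homeomorphism_def by auto
  have \<Phi>: "\<Phi> q \<in> Y" "\<Psi> (\<Phi> q) = q" if "q \<in> T \<times> Z" for q
    using hom that unfolding homeomorphism_def by auto
  have join: "join_vec u (fibre_coord (\<Phi> (u, z))) = \<Phi> (u, z)" if "u \<in> T" "z \<in> Z" for u z
    using join_vec_std_proj_fibre_coord[of "\<Phi> (u, z)"] proj[OF that] by simp
  have tz: "(t, z0) \<in> T \<times> Z" "(t', z0) \<in> T \<times> Z"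
    using t T' z0 Z' by auto
  define p where "p = \<Phi> (t', z0)"
  define x0 where "x0 = fibre_coord (\<Phi> (t, z0))"
  have "coord_analytic_at (\<lambda>i x. x $ i) UNIV (fibre_restrict f t) x0"
    unfolding x0_def by (rule fibre_restrict_analytic_at) (use join[of t z0] f t z0 tz in auto)
  then obtain C where C: "C \<ge> 0" "\<forall>\<^sub>F x in nhds x0. norm (fibre_restrict f t x) \<le> C * norm (x - x0) ^ m"
    using mult_at_growth m x0_def by blast
  obtain B where B: "B \<ge> 0" "\<And>y::'k^('m + 'n). norm (fibre_coord y) \<le> norm y * B"
    using bounded_linear.nonneg_bounded[OF bounded_linear_fibre_coord] by blast
  have p: "p \<in> Y" "\<Psi> p = (t', z0)"
    using \<Phi> tz by (auto simp: p_def)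
  show ?thesis
    unfolding p_def[symmetric]
  proof (rule enat_le_mult_at_if_vanishing_on_lines)
    show "coord_analytic_at (\<lambda>i x. x $ i) UNIV f p"
      using f t z0 by (simp add: p_def)
    fix v :: "'k^('m + 'n)"
    obtain r where r: "r > 0" "ball p r \<subseteq> Y"
      using Y p openE by blast
    \<comment> \<open>At this speed the line stays in the ball around \<open>p\<close> for all
      parameters in (-1,1), so it is an arc in \<open>Y\<close>. The added 1 allows
      \<open>v = 0\<close>.\<close>
    define \<epsilon> where "\<epsilon> = r / (norm v + 1)"
    have \<epsilon>: "\<epsilon> > 0" "\<epsilon> * norm v < r"
      using r by (auto simp: \<epsilon>_def field_simps add_pos_nonneg)
    define \<gamma> where "\<gamma> s = p + (s * \<epsilon>) *\<^sub>R v" for s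
    have \<gamma>_in: "\<gamma> s \<in> Y" if "s \<in> ?I" for s
    proof -
      have "\<bar>s\<bar> * (\<epsilon> * norm v) \<le> 1 * (\<epsilon> * norm v)"
        using that \<epsilon> by (intro mult_right_mono) auto
      also have "\<dots> < r"
        using \<epsilon> by simp
      finally have "dist p (\<gamma> s) < r"
        using \<epsilon>(1) by (simp add: \<gamma>_def dist_norm abs_mult mult.assoc)
      then show ?thesis
        using r by auto
    qed
    have "analytic_arc_in Y \<gamma>"
      unfolding analytic_arc_in_def \<gamma>_def[abs_def]
      using real_analytic_on_line \<gamma>_in by (auto simp: \<gamma>_def)
    then have \<Psi>\<gamma>: "real_analytic_on ?I (\<lambda>s. \<Psi> (\<gamma> s))"
      using arc_inv by (simp add: arc_analytic_on_def)
    define z where "z s = snd (\<Psi> (\<gamma> s))" for s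
    define \<tau> where "\<tau> s = fst (\<Psi> (\<gamma> s))" for s
    have "analytic_arc_in Z z"
      using real_analytic_on_snd[OF \<Psi>\<gamma>] \<Psi>(1)[OF \<gamma>_in]
      by (auto simp: analytic_arc_in_def z_def[abs_def] mem_Times_iff)
    then have "real_analytic_on (T \<times> ?I) (\<lambda>(t, s). \<Phi> (t, z s))"
      by (rule arc)
    moreover have "(t, 0) \<in> T \<times> ?I"
      using tz by simp
    \<comment> \<open>Joint analyticity in (t, s) gives a Lipschitz bound at (t, 0); restricting it
      to the slice with \<open>t\<close> fixed bounds the transported arc by a multiple of
      s.\<close>
    ultimately obtain L where L: "L \<ge> 0" "\<forall>\<^sub>F q in nhds (t, 0).
        norm ((\<lambda>(t, s). \<Phi> (t, z s)) q - (\<lambda>(t, s). \<Phi> (t, z s)) (t, 0)) \<le> L * norm (q - (t, 0))"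
      using real_analytic_on_lipschitz_at by blast
    have z_0: "z 0 = z0"
      by (simp add: z_def \<gamma>_def p)
    have "((\<lambda>s. (t, s)) \<longlongrightarrow> (t, 0)) (at_right (0::real))"
      by (intro tendsto_intros)
    from eventually_compose_filterlim[OF L(2) this]
    have lip: "\<forall>\<^sub>F s in at_right 0. norm (\<Phi> (t, z s) - \<Phi> (t, z0)) \<le> L * \<bar>s\<bar>"
      by (simp add: z_0 norm_Pair)
    then have lip': "\<forall>\<^sub>F s in at_right 0. norm (fibre_coord (\<Phi> (t, z s)) - x0) \<le> L * B * \<bar>s\<bar>"
    proof eventually_elim
      case (elim s)
      have "norm (fibre_coord (\<Phi> (t, z s)) - x0) \<le> norm (\<Phi> (t, z s) - \<Phi> (t, z0)) * B"
        using B(2)[of "\<Phi> (t, z s) - \<Phi> (t, z0)"]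
        by (simp add: x0_def linear_diff[OF bounded_linear.linear[OF bounded_linear_fibre_coord]])
      also have "\<dots> \<le> L * \<bar>s\<bar> * B"
        using elim B by (intro mult_right_mono)
      finally show ?case
        by (simp add: mult_ac)
    qed
    have "((\<lambda>s. fibre_coord (\<Phi> (t, z s)) - x0) \<longlongrightarrow> 0) (at_right 0)"
    proof (rule Lim_null_comparison[OF lip'])
      have "((\<lambda>s::real. L * B * \<bar>s\<bar>) \<longlongrightarrow> L * B * \<bar>0\<bar>) (at_right 0)"
        by (intro tendsto_intros)
      then show "((\<lambda>s::real. L * B * \<bar>s\<bar>) \<longlongrightarrow> 0) (at_right 0)"
        by simp
    qed
    then have "((\<lambda>s. fibre_coord (\<Phi> (t, z s))) \<longlongrightarrow> x0) (at_right 0)"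
      by (simp add: LIM_zero_iff)
    then have growth: "\<forall>\<^sub>F s in at_right 0. norm (fibre_restrict f t (fibre_coord (\<Phi> (t, z s))))
        \<le> C * norm (fibre_coord (\<Phi> (t, z s)) - x0) ^ m"
      by (rule eventually_compose_filterlim[OF C(2)])
    have "((\<lambda>s. \<Psi> (\<gamma> s)) \<longlongrightarrow> \<Psi> (\<gamma> 0)) (nhds 0)"
      by (rule real_analytic_on_tendsto[OF \<Psi>\<gamma>]) simp
    then have "((\<lambda>s. \<Psi> (\<gamma> s)) \<longlongrightarrow> (t', z0)) (at_right 0)"
      by (rule tendsto_mono[rotated, THEN tendsto_eq_rhs]) (simp_all add: at_within_def \<gamma>_def p)
    moreover have "\<forall>\<^sub>F q in nhds (t', z0). q \<in> T' \<times> Z'"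
      using T' Z' t z0 by (intro eventually_nhds_in_open open_Times) auto
    \<comment> \<open>By continuity at s = 0, the lifted line stays in the box on which the
      regularity estimate holds.\<close>
    ultimately have near: "\<forall>\<^sub>F s in at_right 0. \<Psi> (\<gamma> s) \<in> T' \<times> Z'"
      by (rule eventually_compose_filterlim[rotated])
    have "\<forall>\<^sub>F s in at_right (0::real). s \<in> {0<..<1}"
      by (rule eventually_at_right_real) simp
    with lip' growth near
    have "\<forall>\<^sub>F s in at_right 0. norm (f (p + (s * \<epsilon>) *\<^sub>R v)) \<le> \<bar>K\<bar> * (C * (L * B) ^ m) * s ^ m"
    proof eventually_elim
      case (elim s)
      then have s: "0 < s" "s < 1" and zs: "\<tau> s \<in> T'" "z s \<in> Z'"
        by (auto simp: \<tau>_def z_def mem_Times_iff)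
      have "norm (f (\<gamma> s)) = norm (f (\<Phi> (\<tau> s, z s)))"
        using \<Psi>(2)[OF \<gamma>_in[of s]] s by (simp add: \<tau>_def z_def)
      \<comment> \<open>This is where the moving base point \<open>\<tau> s\<close> is exchanged for
        the fixed \<open>t\<close>.\<close>
      also have "\<dots> \<le> K * norm (f (\<Phi> (t, z s)))"
        by (rule regular[OF t(1) zs])
      also have "\<dots> \<le> \<bar>K\<bar> * norm (f (\<Phi> (t, z s)))"
        by (intro mult_right_mono) auto
      also have "f (\<Phi> (t, z s)) = fibre_restrict f t (fibre_coord (\<Phi> (t, z s)))"
        using join[of t "z s"] zs Z' tz by (auto simp: fibre_restrict_def)
      also have "\<bar>K\<bar> * norm \<dots> \<le> \<bar>K\<bar> * (C * norm (fibre_coord (\<Phi> (t, z s)) - x0) ^ m)"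
        using elim by (intro mult_left_mono) auto
      also have "\<dots> \<le> \<bar>K\<bar> * (C * (L * B * \<bar>s\<bar>) ^ m)"
        using elim C by (intro mult_left_mono power_mono) auto
      also have "\<dots> = \<bar>K\<bar> * (C * (L * B) ^ m) * s ^ m"
        using s by (simp add: power_mult_distrib)
      finally show ?case
        by (simp add: \<gamma>_def)
    qed
    then show "\<exists>\<epsilon>>0. \<exists>C. \<forall>\<^sub>F s in at_right 0. norm (f (p + (s * \<epsilon>) *\<^sub>R v)) \<le> C * s ^ m"
      using \<epsilon>(1) by blast
  qed
qed

theorem proposition1p13:
  fixes T :: "('k::real_or_complex^'m) set"
    and Z :: "('k^'n) set"
    and Y U :: "('k^('m::finite + 'n::finite)) set"
    and \<Phi> :: "('k^'m) \<times> ('k^'n) \<Rightarrow> 'k^('m::finite + 'n::finite)"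
    and f :: "'k^('m::finite + 'n::finite) \<Rightarrow> 'k"
    and t0 :: "'k^'m" and z0 :: "'k^'n" and y0 :: "'k^('m::finite + 'n::finite)"
  assumes "open T" and "open Z" and "open Y"
    and "arcwise_analytic_trivialization T Z Y \<Phi>"
    and "t0 \<in> T" and "z0 \<in> Z" and "y0 = \<Phi> (t0, z0)"
    and "open U" and "y0 \<in> U" and "U \<subseteq> Y" and "K_analytic_on U f" and "f y0 = 0"
    and "Phi_regular \<Phi> t0 z0 f"
  shows "\<forall>\<^sub>F t in nhds t0.
           mult_at y0 f = mult_at (\<Phi> (t, z0)) f \<and>
           mult_at (\<Phi> (t, z0)) f = mult_at (fibre_coord y0) (fibre_restrict f t0) \<and>
           mult_at (fibre_coord y0) (fibre_restrict f t0) =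
             mult_at (fibre_coord (\<Phi> (t, z0))) (fibre_restrict f t)"
proof -
  have cont: "continuous_on (T \<times> Z) \<Phi>"
    using arcwise_analytic_trivializationD(1)[OF assms(4)] by (simp add: homeomorphism_def)
  note proj = arcwise_analytic_trivializationD(3)[OF assms(4)]
  obtain C where "C > 0" and C: "\<forall>\<^sub>F (t, z) in nhds (t0, z0).
      inverse C * norm (f (\<Phi> (t0, z))) \<le> norm (f (\<Phi> (t, z))) \<and>
      norm (f (\<Phi> (t, z))) \<le> C * norm (f (\<Phi> (t0, z)))"
    using assms(13) unfolding Phi_regular_def by blast
  have "isCont \<Phi> (t0, z0)"
    using cont assms(1,2,5,6) by (intro continuous_on_interior) (auto simp: interior_open open_Times)
  then have "\<forall>\<^sub>F q in nhds (t0, z0). \<Phi> q \<in> U"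
    using assms(7-9) eventually_nhds_in_open[of U "\<Phi> (t0, z0)"]
    by (auto simp: continuous_at filterlim_iff eventually_nhds_conv_at tendsto_def)
  moreover have "\<forall>\<^sub>F q in nhds (t0, z0). q \<in> T \<times> Z"
    using assms(1,2,5,6) by (intro eventually_nhds_in_open open_Times) auto
  ultimately have "\<forall>\<^sub>F (t, z) in nhds (t0, z0). \<Phi> (t, z) \<in> U \<and> t \<in> T \<and> z \<in> Z \<and>
      inverse C * norm (f (\<Phi> (t0, z))) \<le> norm (f (\<Phi> (t, z))) \<and>
      norm (f (\<Phi> (t, z))) \<le> C * norm (f (\<Phi> (t0, z)))"
    using C by eventually_elim auto
  then obtain S where S: "open S" "(t0, z0) \<in> S" "\<And>t z. (t, z) \<in> S \<Longrightarrow> \<Phi> (t, z) \<in> U \<and> t \<in> T \<and> z \<in> Z \<and>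
      inverse C * norm (f (\<Phi> (t0, z))) \<le> norm (f (\<Phi> (t, z))) \<and>
      norm (f (\<Phi> (t, z))) \<le> C * norm (f (\<Phi> (t0, z)))"
    unfolding eventually_nhds by fast
  \<comment> \<open>A product neighbourhood is required so that t and z can be varied
    independently.\<close>
  obtain T' Z' where TZ': "open T'" "open Z'" "t0 \<in> T'" "z0 \<in> Z'" "T' \<times> Z' \<subseteq> S"
    using open_prod_elim[OF S(1,2)] by (metis mem_Sigma_iff)
  have local: "\<Phi> (t, z) \<in> U" "t \<in> T" "z \<in> Z"
    "norm (f (\<Phi> (t0, z))) \<le> C * norm (f (\<Phi> (t, z)))"
    "norm (f (\<Phi> (t, z))) \<le> C * norm (f (\<Phi> (t0, z)))" if "t \<in> T'" "z \<in> Z'" for t z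
    using S(3)[of t z] TZ' that \<open>C > 0\<close> by (auto simp: field_simps)
  \<comment> \<open>Regularity compares each fibre with the one over \<open>t0\<close>; two
    arbitrary fibres are compared through it, which costs the factor \<open>C\<close> twice.\<close>
  have regular: "norm (f (\<Phi> (t', z))) \<le> C * C * norm (f (\<Phi> (t, z)))"
    if "t \<in> T'" "t' \<in> T'" "z \<in> Z'" for t t' z
  proof -
    have "norm (f (\<Phi> (t', z))) \<le> C * norm (f (\<Phi> (t0, z)))"
      using local that by blast
    also have "\<dots> \<le> C * (C * norm (f (\<Phi> (t, z))))"
      using local(4)[of t z] that \<open>C > 0\<close> by simp
    finally show ?thesis by (simp add: mult.assoc)
  qed
  have f: "coord_analytic_at (\<lambda>i x. x $ i) UNIV f (\<Phi> (t, z))" if "t \<in> T'" "z \<in> Z'" for t z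
    using local(1)[OF that] assms(11) by (simp add: K_analytic_on_def)
  define a where "a t = mult_at (\<Phi> (t, z0)) f" for t
  define b where "b t = mult_at (fibre_coord (\<Phi> (t, z0))) (fibre_restrict f t)" for t
  have ab: "a t \<le> b t" if "t \<in> T'" for t
  proof (rule le_if_all_enat_le)
    have "join_vec t (fibre_coord (\<Phi> (t, z0))) = \<Phi> (t, z0)"
      using join_vec_std_proj_fibre_coord[of "\<Phi> (t, z0)"] proj[of t z0] local[OF that] TZ' by simp
    then show "enat m \<le> b t" if "enat m \<le> a t" for m
      using mult_at_le_mult_at_fibre_restrict[of f t "fibre_coord (\<Phi> (t, z0))" m] f that \<open>t \<in> T'\<close> TZ'
      by (simp add: a_def b_def)
  qed
  have ba: "b t \<le> a t'" if "t \<in> T'" "t' \<in> T'" for t t'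
  proof (rule le_if_all_enat_le)
    show "enat m \<le> a t'" if "enat m \<le> b t" for m
      unfolding a_def
    proof (rule mult_at_fibre_restrict_le_mult_at[OF assms(3,4) TZ'(1) _ TZ'(2) _ f regular])
      show "T' \<subseteq> T" "Z' \<subseteq> Z"
        using local TZ' by auto
    qed (use that \<open>t \<in> T'\<close> \<open>t' \<in> T'\<close> TZ' in \<open>auto simp: b_def\<close>)
  qed
  have "\<forall>\<^sub>F t in nhds t0. t \<in> T'"
    using TZ' by (intro eventually_nhds_in_open)
  then show ?thesis
  proof eventually_elim
    case (elim t)
    \<comment> \<open>The inequalities close up into the cycle
      \<open>b t0 \<le> a t \<le> b t \<le> a t0 \<le> b t0\<close>.\<close>
    have "a t0 = a t" "a t = b t0" "b t0 = b t"
      using ab[of t] ab[of t0] ba[of t t] ba[of t t0] ba[of t0 t] ba[of t0 t0] elim TZ'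
      by (auto intro: antisym order_trans)
    then show ?case
      unfolding a_def b_def assms(7) by simp
  qed
qed

end
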